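(* Assume $\Sigma^{(e)}\succ0$ for every $e\in\mathcal E$ and $\Sigma_{j,j}=1$ for every $j\in[d]$. Let $k\in[d]$, $\gamma\ge0$, and let $\beta^{k,\gamma}$ be the unique minimizer of $\mathsf Q_{k,\gamma}$ over $\mathbb R^d$. Suppose: (1) (invariance) there is $\beta^\star\in\mathbb R^d$ with support $S^\star$ such that for every $e\in\mathcal E$, $Y^{(e)}=(\beta^\star_{S^\star})^\top X_{S^\star}^{(e)}+\varepsilon^{(e)}$ with $\mathbb E[X^{(e)}_{S^\star}\varepsilon^{(e)}]=0$; (2) (identification) with $G=\{j\notin S^\star:\frac1{|\mathcal E|}\sum_{e\in\mathcal E}\mathbb E[\varepsilon^{(e)}X_j^{(e)}]\neq0\}$, for every $S\subseteq[d]$ with $S\cap G\neq\emptyset$ there exist $e,e'\in\mathcal E$ with $\beta^{(e,S)}\ne\beta^{(e',S)}$; (3) (restricted invariance) for every $j\in S^\star$ there exists $S\subseteq[d]$ with $|S|\le k$ and $j\in S$ such that $\beta^{(e,S)}=\beta^{(S)}$ for all $e\in\mathcal E$. Then $\beta^{k,\gamma}=\beta^\star$ whenever $$\gamma\ge\gamma_k^\star:=\max_{j\in G}\Big|\tfrac1{|\mathcal E|}\sum_{e\in\mathcal E}\mathbb E[X_j^{(e)}\varepsilon^{(e)}]\Big|\Big/w_k(j).$$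
   Context: $\mathcal E$ is a finite set of environments; for each $e\in\mathcal E$, $(X^{(e)},Y^{(e)})\in\mathbb R^d\times\mathbb R$ is a random pair with finite second moments. $\Sigma^{(e)}=\mathbb E[X^{(e)}(X^{(e)})^\top]$, $\Sigma=\frac1{|\mathcal E|}\sum_e\Sigma^{(e)}$. For $S\subseteq[d]$, $\beta^{(e,S)}=\arg\min_{\mathrm{supp}(\beta)\subseteq S}\mathbb E[|Y^{(e)}-\beta^\top X^{(e)}|^2]$ and $\beta^{(S)}=\arg\min_{\mathrm{supp}(\beta)\subseteq S}\sum_{e}\mathbb E[|Y^{(e)}-\beta^\top X^{(e)}|^2]$. With $\|z\|_A=\sqrt{z^\top Az}$ and subscript $S$ denoting subvector / principal submatrix, define $$w_k(j)=\sqrt{\min_{S:\,j\in S,\,|S|\le k}\ \tfrac1{|\mathcal E|}\sum_{e\in\mathcal E}\|\beta_S^{(e,S)}-\beta_S^{(S)}\|^2_{\Sigma_S^{(e)}}},$$ $$\mathsf Q_{k,\gamma}(\beta)=\tfrac1{2|\mathcal E|}\sum_{e\in\mathcal E}\mathbb E[|Y^{(e)}-\beta^\top X^{(e)}|^2]+\gamma\sum_{j=1}^d|\beta_j|\,w_k(j).$$ A maximum over the empty set is taken to be $0$. *)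

theory Defs
  imports "HOL-Probability.Probability"
begin

text \<open>
  The coordinate set [d] is the finite index type of the vectors. In the environment \<open>e\<close> the pair
  \<open>(X e, Y e)\<close> lives on its own probability space \<open>M e\<close>.
\<close>

definition vsupp :: "real ^ 'd \<Rightarrow> 'd set" where
  "vsupp b = {j. b $ j \<noteq> 0}"

definition pos_definite :: "real ^ 'd ^ 'd \<Rightarrow> bool" where
  "pos_definite A \<longleftrightarrow> transpose A = A \<and> (\<forall>v. v \<noteq> 0 \<longrightarrow> v \<bullet> (A *v v) > 0)"

definition avg :: "'e set \<Rightarrow> ('e \<Rightarrow> real) \<Rightarrow> real" where
  "avg E f = 1 / real (card E) * (\<Sum>e\<in>E. f e)"

definition second_moment :: "'w measure \<Rightarrow> ('w \<Rightarrow> real ^ 'd) \<Rightarrow> real ^ 'd ^ 'd" where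
  "second_moment N Z = (\<chi> i j. \<integral>\<omega>. Z \<omega> $ i * Z \<omega> $ j \<partial>N)"

definition avg_second_moment ::
  "'e set \<Rightarrow> ('e \<Rightarrow> 'w measure) \<Rightarrow> ('e \<Rightarrow> 'w \<Rightarrow> real ^ 'd) \<Rightarrow> real ^ 'd ^ 'd" where
  "avg_second_moment E M X = (1 / real (card E)) *\<^sub>R (\<Sum>e\<in>E. second_moment (M e) (X e))"

definition risk :: "'w measure \<Rightarrow> ('w \<Rightarrow> real ^ 'd) \<Rightarrow> ('w \<Rightarrow> real) \<Rightarrow> real ^ 'd \<Rightarrow> real" where
  "risk N Z V b = (\<integral>\<omega>. \<bar>V \<omega> - b \<bullet> Z \<omega>\<bar>\<^sup>2 \<partial>N)"

definition beta_env ::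
  "'w measure \<Rightarrow> ('w \<Rightarrow> real ^ 'd) \<Rightarrow> ('w \<Rightarrow> real) \<Rightarrow> 'd set \<Rightarrow> real ^ 'd" where
  "beta_env N Z V S = arg_min_on (risk N Z V) {b. vsupp b \<subseteq> S}"

definition beta_pooled ::
  "'e set \<Rightarrow> ('e \<Rightarrow> 'w measure) \<Rightarrow> ('e \<Rightarrow> 'w \<Rightarrow> real ^ 'd) \<Rightarrow> ('e \<Rightarrow> 'w \<Rightarrow> real) \<Rightarrow>
    'd set \<Rightarrow> real ^ 'd" where
  "beta_pooled E M X Y S =
     arg_min_on (\<lambda>b. \<Sum>e\<in>E. risk (M e) (X e) (Y e) b) {b. vsupp b \<subseteq> S}"

text \<open>
  \<open>sub_norm A S z\<close> is the norm of the subvector of \<open>z\<close> on \<open>S\<close>, weighted by the principal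
  submatrix of \<open>A\<close> on \<open>S\<close>; the subvector and submatrix are not separate objects, the indices
  just range over \<open>S\<close>.
\<close>

definition sub_norm :: "real ^ 'd ^ 'd \<Rightarrow> 'd set \<Rightarrow> real ^ 'd \<Rightarrow> real" where
  "sub_norm A S z = sqrt (\<Sum>i\<in>S. \<Sum>j\<in>S. z $ i * A $ i $ j * z $ j)"

definition w_weight ::
  "'e set \<Rightarrow> ('e \<Rightarrow> 'w measure) \<Rightarrow> ('e \<Rightarrow> 'w \<Rightarrow> real ^ 'd) \<Rightarrow> ('e \<Rightarrow> 'w \<Rightarrow> real) \<Rightarrow>
    nat \<Rightarrow> 'd \<Rightarrow> real" where
  "w_weight E M X Y k j =
     sqrt (MIN S\<in>{S. j \<in> S \<and> card S \<le> k}.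
       avg E (\<lambda>e. (sub_norm (second_moment (M e) (X e)) S
                     (beta_env (M e) (X e) (Y e) S - beta_pooled E M X Y S))\<^sup>2))"

definition Q_obj ::
  "'e set \<Rightarrow> ('e \<Rightarrow> 'w measure) \<Rightarrow> ('e \<Rightarrow> 'w \<Rightarrow> real ^ 'd) \<Rightarrow> ('e \<Rightarrow> 'w \<Rightarrow> real) \<Rightarrow>
    nat \<Rightarrow> real \<Rightarrow> real ^ 'd \<Rightarrow> real" where
  "Q_obj E M X Y k \<gamma> b =
     1 / (2 * real (card E)) * (\<Sum>e\<in>E. risk (M e) (X e) (Y e) b)
       + \<gamma> * (\<Sum>j\<in>UNIV. \<bar>b $ j\<bar> * w_weight E M X Y k j)"

definition beta_reg ::
  "'e set \<Rightarrow> ('e \<Rightarrow> 'w measure) \<Rightarrow> ('e \<Rightarrow> 'w \<Rightarrow> real ^ 'd) \<Rightarrow> ('e \<Rightarrow> 'w \<Rightarrow> real) \<Rightarrow>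
    nat \<Rightarrow> real \<Rightarrow> real ^ 'd" where
  "beta_reg E M X Y k \<gamma> = arg_min_on (Q_obj E M X Y k \<gamma>) UNIV"

definition endogenous_set ::
  "'e set \<Rightarrow> ('e \<Rightarrow> 'w measure) \<Rightarrow> ('e \<Rightarrow> 'w \<Rightarrow> real ^ 'd) \<Rightarrow> ('e \<Rightarrow> 'w \<Rightarrow> real) \<Rightarrow>
    'd set \<Rightarrow> 'd set" where
  "endogenous_set E M X \<epsilon> Sstar =
     {j. j \<notin> Sstar \<and> avg E (\<lambda>e. \<integral>\<omega>. \<epsilon> e \<omega> * X e \<omega> $ j \<partial>(M e)) \<noteq> 0}"

definition gamma_star ::
  "'e set \<Rightarrow> ('e \<Rightarrow> 'w measure) \<Rightarrow> ('e \<Rightarrow> 'w \<Rightarrow> real ^ 'd) \<Rightarrow> ('e \<Rightarrow> 'w \<Rightarrow> real) \<Rightarrow>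
    ('e \<Rightarrow> 'w \<Rightarrow> real) \<Rightarrow> nat \<Rightarrow> 'd set \<Rightarrow> real" where
  "gamma_star E M X Y \<epsilon> k G =
     (if G = {} then 0
      else MAX j\<in>G. \<bar>avg E (\<lambda>e. \<integral>\<omega>. X e \<omega> $ j * \<epsilon> e \<omega> \<partial>(M e))\<bar> / w_weight E M X Y k j)"

end

theory Submission
  imports Defs
begin

text \<open>
  The objective is a strictly convex quadratic plus a convex penalty, so it has exactly one
  minimiser. Restricted invariance makes the weights vanish on the support of \<open>\<beta>star\<close>, and so the
  penalty vanishes at \<open>\<beta>star\<close>; identification makes the weights positive on \<open>G\<close>. The gradient of
  the averaged risk at \<open>\<beta>star\<close> is the negative of the vector of averaged correlations
  \<open>E[X\<^sub>j \<epsilon>]\<close>, which is zero outside \<open>G\<close> and, for \<open>\<gamma> \<ge> gamma_star\<close>, is dominated on \<open>G\<close> by the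
  slope \<open>\<gamma> w\<^sub>j\<close> of the penalty. Hence no move away from \<open>\<beta>star\<close> decreases the objective.
\<close>

section \<open>Square-integrable random vectors and the expansion of the risk\<close>

lemma integrable_mult_of_squares:
  fixes f g :: "'w \<Rightarrow> real"
  assumes [measurable]: "f \<in> borel_measurable N" "g \<in> borel_measurable N"
    and "integrable N (\<lambda>\<omega>. (f \<omega>)\<^sup>2)" "integrable N (\<lambda>\<omega>. (g \<omega>)\<^sup>2)"
  shows "integrable N (\<lambda>\<omega>. f \<omega> * g \<omega>)"
proof (rule Bochner_Integration.integrable_bound)
  show "integrable N (\<lambda>\<omega>. (f \<omega>)\<^sup>2 + (g \<omega>)\<^sup>2)"
    using assms by simp
  have "\<bar>x * y\<bar> \<le> x\<^sup>2 + y\<^sup>2" for x y :: real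
  proof -
    have "0 \<le> (\<bar>x\<bar> - \<bar>y\<bar>)\<^sup>2" by simp
    then have "2 * (\<bar>x\<bar> * \<bar>y\<bar>) \<le> x\<^sup>2 + y\<^sup>2"
      by (simp add: power2_diff algebra_simps)
    moreover have "0 \<le> \<bar>x\<bar> * \<bar>y\<bar>" by simp
    ultimately show ?thesis unfolding abs_mult by linarith
  qed
  then show "AE \<omega> in N. norm (f \<omega> * g \<omega>) \<le> norm ((f \<omega>)\<^sup>2 + (g \<omega>)\<^sup>2)"
    by (simp add: abs_of_nonneg)
qed simp

lemma square_integrable_add_scaled:
  fixes f g :: "'w \<Rightarrow> real"
  assumes "f \<in> borel_measurable N" "g \<in> borel_measurable N"
    and "integrable N (\<lambda>\<omega>. (f \<omega>)\<^sup>2)" "integrable N (\<lambda>\<omega>. (g \<omega>)\<^sup>2)"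
  shows "integrable N (\<lambda>\<omega>. (f \<omega> + c * g \<omega>)\<^sup>2)"
proof -
  have "(\<lambda>\<omega>. (f \<omega> + c * g \<omega>)\<^sup>2) = (\<lambda>\<omega>. (f \<omega>)\<^sup>2 + 2 * c * (f \<omega> * g \<omega>) + c\<^sup>2 * (g \<omega>)\<^sup>2)"
    by (simp add: power2_eq_square algebra_simps)
  then show ?thesis
    using assms integrable_mult_of_squares[OF assms] by simp
qed

lemma inner_vec_sum: "(x :: real ^ 'd) \<bullet> y = (\<Sum>i\<in>UNIV. x $ i * y $ i)"
  by (simp add: inner_vec_def)

lemma quadratic_form_sum:
  fixes A :: "real ^ 'd ^ 'd"
  shows "x \<bullet> (A *v y) = (\<Sum>i\<in>UNIV. \<Sum>j\<in>UNIV. x $ i * A $ i $ j * y $ j)"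
  by (simp add: inner_vec_sum matrix_vector_mult_def sum_distrib_left mult.assoc)

locale second_order =
  fixes N :: "'w measure" and Z :: "'w \<Rightarrow> real ^ 'd"
  assumes meas: "Z \<in> borel_measurable N"
    and sq_norm: "integrable N (\<lambda>\<omega>. (norm (Z \<omega>))\<^sup>2)"
begin

lemma inner_measurable [measurable]: "(\<lambda>\<omega>. b \<bullet> Z \<omega>) \<in> borel_measurable N"
  using meas by simp

lemma component_measurable [measurable]: "(\<lambda>\<omega>. Z \<omega> $ j) \<in> borel_measurable N"
  using inner_measurable[of "axis j 1"] by (simp add: inner_axis')

lemma inner_sq_integrable: "integrable N (\<lambda>\<omega>. (b \<bullet> Z \<omega>)\<^sup>2)"
proof (rule Bochner_Integration.integrable_bound)
  show "integrable N (\<lambda>\<omega>. (norm b)\<^sup>2 * (norm (Z \<omega>))\<^sup>2)"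
    using sq_norm by simp
  have "(b \<bullet> z)\<^sup>2 \<le> (norm b)\<^sup>2 * (norm z)\<^sup>2" for z
    using Cauchy_Schwarz_ineq[of b z] by (simp add: power2_norm_eq_inner)
  then show "AE \<omega> in N. norm ((b \<bullet> Z \<omega>)\<^sup>2) \<le> norm ((norm b)\<^sup>2 * (norm (Z \<omega>))\<^sup>2)"
    by simp
qed simp

lemma component_sq_integrable: "integrable N (\<lambda>\<omega>. (Z \<omega> $ j)\<^sup>2)"
  using inner_sq_integrable[of "axis j 1"] by (simp add: inner_axis')

lemma component_mult_integrable:
  assumes "W \<in> borel_measurable N" "integrable N (\<lambda>\<omega>. (W \<omega>)\<^sup>2)"
  shows "integrable N (\<lambda>\<omega>. Z \<omega> $ j * W \<omega>)"
  by (rule integrable_mult_of_squares) (use assms component_sq_integrable in auto)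

lemma second_moment_form:
  "h \<bullet> (second_moment N Z *v h) = (\<integral>\<omega>. (h \<bullet> Z \<omega>)\<^sup>2 \<partial>N)"
proof -
  have int: "integrable N (\<lambda>\<omega>. Z \<omega> $ i * Z \<omega> $ j)" for i j
    by (rule component_mult_integrable) (use component_sq_integrable in auto)
  have "(h \<bullet> z)\<^sup>2 = (\<Sum>i\<in>UNIV. \<Sum>j\<in>UNIV. h $ i * h $ j * (z $ i * z $ j))" for z
    by (simp add: inner_vec_sum power2_eq_square sum_product algebra_simps)
  then show ?thesis
    by (simp add: quadratic_form_sum second_moment_def int Bochner_Integration.integral_sum
        algebra_simps)
qed

text \<open>An exact second-order Taylor expansion, obtained by squaring the residual at
  \<open>b\<close> minus \<open>h \<bullet> Z \<omega>\<close>. The gradient at \<open>b\<close> is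
  minus twice the vector of correlations between \<open>Z\<close> and that residual. All later facts
  about minimisers of the risk start from this identity.\<close>

lemma risk_expand:
  assumes V[measurable]: "V \<in> borel_measurable N" and V2: "integrable N (\<lambda>\<omega>. (V \<omega>)\<^sup>2)"
  shows "risk N Z V (b + h) = risk N Z V b
     - 2 * (h \<bullet> (\<chi> j. \<integral>\<omega>. Z \<omega> $ j * (V \<omega> - b \<bullet> Z \<omega>) \<partial>N)) + h \<bullet> (second_moment N Z *v h)"
proof -
  define W where "W \<omega> = V \<omega> - b \<bullet> Z \<omega>" for \<omega>
  have W[measurable]: "W \<in> borel_measurable N"
    unfolding W_def by measurable
  have W2: "integrable N (\<lambda>\<omega>. (W \<omega>)\<^sup>2)"
    \<comment> \<open>The residual is the sum of \<open>V\<close> and \<open>-1\<close> times the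
      linear prediction.\<close>
    using square_integrable_add_scaled[OF V inner_measurable V2 inner_sq_integrable, of "-1" b]
    by (simp add: W_def)
  have hW: "h \<bullet> Z \<omega> * W \<omega> = (\<Sum>j\<in>UNIV. h $ j * (Z \<omega> $ j * W \<omega>))" for \<omega>
    by (simp add: inner_vec_sum sum_distrib_right mult.assoc)
  have int: "integrable N (\<lambda>\<omega>. h \<bullet> Z \<omega> * W \<omega>)"
    by (simp add: hW component_mult_integrable[OF W W2])
  have "risk N Z V (b + h) = (\<integral>\<omega>. (W \<omega>)\<^sup>2 - 2 * (h \<bullet> Z \<omega> * W \<omega>) + (h \<bullet> Z \<omega>)\<^sup>2 \<partial>N)"
    unfolding risk_def W_def
    by (rule Bochner_Integration.integral_cong)
      (simp_all add: inner_add_left power2_eq_square algebra_simps)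
  also have "\<dots> = (\<integral>\<omega>. (W \<omega>)\<^sup>2 \<partial>N) - 2 * (\<integral>\<omega>. h \<bullet> Z \<omega> * W \<omega> \<partial>N) + (\<integral>\<omega>. (h \<bullet> Z \<omega>)\<^sup>2 \<partial>N)"
    using W2 int inner_sq_integrable by simp
  also have "(\<integral>\<omega>. h \<bullet> Z \<omega> * W \<omega> \<partial>N) = h \<bullet> (\<chi> j. \<integral>\<omega>. Z \<omega> $ j * W \<omega> \<partial>N)"
    unfolding hW
    by (simp add: inner_vec_sum component_mult_integrable[OF W W2] Bochner_Integration.integral_sum)
  finally show ?thesis
    by (simp add: second_moment_form risk_def W_def)
qed

end

section \<open>Positive definite quadratic forms and their minimisation\<close>

lemma pos_definite_scaleR:
  assumes "pos_definite A" "0 < c"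
  shows "pos_definite (c *\<^sub>R A)"
  using assms
  by (auto simp: pos_definite_def transpose_def vec_eq_iff scaleR_matrix_vector_assoc[symmetric])

lemma pos_definite_sum:
  assumes "finite E" "E \<noteq> {}" "\<And>e. e \<in> E \<Longrightarrow> pos_definite (A e)"
  shows "pos_definite (\<Sum>e\<in>E. A e)"
  using assms
proof (induction rule: finite_ne_induct)
  case (insert e F)
  have "pos_definite (B + C)" if "pos_definite B" "pos_definite C" for B C :: "real ^ 'b ^ 'b"
    using that
    by (auto simp: pos_definite_def transpose_def vec_eq_iff matrix_vector_mult_add_rdistrib
        inner_add_right add_pos_pos)
  with insert show ?case by simp
qed simp

lemma sum_matrix_form:
  fixes A :: "'e \<Rightarrow> real ^ 'd ^ 'd"
  shows "x \<bullet> ((\<Sum>e\<in>E. A e) *v y) = (\<Sum>e\<in>E. x \<bullet> (A e *v y))"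
  by (induction E rule: infinite_finite_induct)
    (simp_all add: matrix_vector_mult_add_rdistrib inner_add_right)

text \<open>The constant \<open>l\<close> is the minimum of the form over the compact unit sphere;
  it is positive because the minimiser is nonzero. Homogeneity of degree two carries the bound to
  all vectors.\<close>

lemma pos_definite_coercive:
  fixes A :: "real ^ 'd ^ 'd"
  assumes "pos_definite A"
  obtains l where "0 < l" "\<And>x. l * (norm x)\<^sup>2 \<le> x \<bullet> (A *v x)"
proof -
  let ?q = "\<lambda>x. x \<bullet> (A *v x)"
  have cont: "continuous_on (sphere 0 1) ?q"
    by (intro continuous_intros matrix_vector_mult_linear_continuous_on)
  have "sphere (0 :: real ^ 'd) 1 \<noteq> {}" by simp
  then obtain u where u: "u \<in> sphere 0 1" "\<And>x. x \<in> sphere 0 1 \<Longrightarrow> ?q u \<le> ?q x"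
    using continuous_attains_inf[OF compact_sphere _ cont] by blast
  have "?q u * (norm x)\<^sup>2 \<le> ?q x" for x
  proof (cases "x = 0")
    case False
    then have "?q u \<le> ?q (x /\<^sub>R norm x)"
      by (intro u) simp
    also have "\<dots> = ?q x / (norm x)\<^sup>2"
      by (simp add: matrix_vector_mult_scaleR power2_eq_square divide_inverse)
    finally show ?thesis
      using False by (simp add: field_simps)
  qed simp
  moreover have "0 < ?q u"
  proof -
    have "u \<noteq> 0" using u(1) by auto
    with assms show ?thesis by (simp add: pos_definite_def)
  qed
  ultimately show thesis using that by blast
qed

text \<open>By coercivity the sublevel sets are bounded, so those inside a closed set are compact.
  The generality in \<open>C\<close> and \<open>p\<close> covers both least squares with restricted
  support (\<open>p\<close> zero) and the penalised objective (\<open>C\<close> the whole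
  space).\<close>

lemma quadratic_minimizer_exists:
  fixes A :: "real ^ 'd ^ 'd"
  assumes A: "pos_definite A"
    and C: "closed C" "C \<noteq> {}"
    and p: "continuous_on UNIV p" "\<And>b. 0 \<le> p b"
    and f: "\<And>b. f b = c + v \<bullet> b + b \<bullet> (A *v b) + p b"
  shows "\<exists>b. is_arg_min f (\<lambda>b. b \<in> C) b"
proof -
  obtain l where l: "0 < l" "\<And>x. l * (norm x)\<^sup>2 \<le> x \<bullet> (A *v x)"
    using pos_definite_coercive[OF A] by blast
  obtain b0 where b0: "b0 \<in> C" using C by blast
  \<comment> \<open>The radius is chosen so that \<open>norm b > R\<close> gives
    \<open>l * (norm b)\<^sup>2 > norm v * norm b + K * norm b\<close>. The summand 1 in
    \<open>R\<close> ensures \<open>norm b \<ge> 1\<close>, hence \<open>K \<le> K * norm b\<close>,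
    and then \<open>f b - c > K \<ge> f b0 - c\<close>.\<close>
  define K where "K = \<bar>f b0 - c\<bar>"
  define R where "R = 1 + (norm v + K) / l"
  let ?L = "{b. f b \<le> f b0} \<inter> C"
  have cont: "continuous_on UNIV f"
    unfolding f
    by (intro continuous_intros p matrix_vector_mult_linear_continuous_on)
  have "norm b \<le> R" if "f b \<le> f b0" for b
  proof (rule ccontr)
    assume "\<not> norm b \<le> R"
    then have R: "R < norm b" by simp
    have K: "0 \<le> K" by (simp add: K_def)
    have 1: "1 \<le> norm b"
    proof -
      have "0 \<le> (norm v + K) / l" using l K by simp
      then show ?thesis using R by (simp add: R_def)
    qed
    have "(norm v + K) / l < norm b"
      using R by (simp add: R_def)
    then have "norm v + K < l * norm b"
      using l by (simp add: field_simps)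
    then have "(norm v + K) * norm b < l * norm b * norm b"
      using 1 by (intro mult_strict_right_mono) auto
    then have "norm v * norm b + K * norm b < l * (norm b)\<^sup>2"
      by (simp add: power2_eq_square algebra_simps)
    moreover have "K \<le> K * norm b"
      using 1 K by (simp add: mult_le_cancel_left1)
    moreover have "- (norm v * norm b) \<le> v \<bullet> b"
      using Cauchy_Schwarz_ineq2[of v b] by linarith
    moreover have "f b0 - c \<le> K" by (simp add: K_def)
    ultimately show False
      using that l(2)[of b] p(2)[of b] by (simp add: f)
  qed
  then have "bounded ?L"
    by (auto simp: bounded_iff)
  moreover have "closed ?L"
    using cont C by (intro closed_Int closed_Collect_le) auto
  ultimately have "compact ?L"
    by (simp add: compact_eq_bounded_closed)
  then obtain m where m: "m \<in> ?L" "\<And>b. b \<in> ?L \<Longrightarrow> f m \<le> f b"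
    using continuous_attains_inf[of ?L f] b0 continuous_on_subset[OF cont] by blast
  \<comment> \<open>Points of \<open>C\<close> outside the sublevel set have values above
    \<open>f b0\<close>, which is at least \<open>f m\<close>.\<close>
  then have "is_arg_min f (\<lambda>b. b \<in> C) m"
    unfolding is_arg_min_linorder by (metis (mono_tags, lifting) IntD1 IntD2 IntI linear
        mem_Collect_eq order_trans)
  then show ?thesis by blast
qed

text \<open>Uses the midpoint identity \<open>q ((x + y) / 2) = (q x + q y) / 2 - q (x - y) / 4\<close> of a
  quadratic form \<open>q\<close>.\<close>

lemma quadratic_minimizer_unique:
  fixes A :: "real ^ 'd ^ 'd"
  assumes A: "pos_definite A"
    and p: "convex_on UNIV p"
    and f: "\<And>b. f b = c + v \<bullet> b + b \<bullet> (A *v b) + p b"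
    and x: "\<And>b. f x \<le> f b" and y: "\<And>b. f y \<le> f b"
  shows "x = y"
proof (rule ccontr)
  assume "x \<noteq> y"
  then have pos: "0 < (x - y) \<bullet> (A *v (x - y))"
    using A by (simp add: pos_definite_def)
  let ?m = "(1/2) *\<^sub>R x + (1/2) *\<^sub>R y"
  have "p ?m \<le> (1/2) * p x + (1/2) * p y"
    using convex_onD[OF p, of "1/2" x y] by simp
  moreover have "?m \<bullet> (A *v ?m) = (x \<bullet> (A *v x) + y \<bullet> (A *v y)) / 2
      - ((x - y) \<bullet> (A *v (x - y))) / 4"
    by (simp add: matrix_vector_right_distrib matrix_vector_mult_diff_distrib
        matrix_vector_mult_scaleR inner_simps field_simps)
  moreover have "v \<bullet> ?m = (v \<bullet> x + v \<bullet> y) / 2"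
    by (simp add: inner_simps field_simps)
  ultimately have "f ?m < (f x + f y) / 2"
    using pos by (simp add: f field_simps)
  with x[of ?m] y[of ?m] show False by simp
qed

section \<open>Vectors with restricted support\<close>

lemma sub_norm_supported:
  assumes "vsupp z \<subseteq> S" "pos_definite A"
  shows "(sub_norm A S z)\<^sup>2 = z \<bullet> (A *v z)"
proof -
  have 0: "z $ i = 0" if "i \<notin> S" for i
    using that assms by (auto simp: vsupp_def)
  have "(\<Sum>i\<in>S. \<Sum>j\<in>S. z $ i * A $ i $ j * z $ j)
      = (\<Sum>i\<in>UNIV. \<Sum>j\<in>UNIV. z $ i * A $ i $ j * z $ j)"
    by (intro sum.mono_neutral_cong_left sum.mono_neutral_left) (auto simp: 0 intro!: sum.neutral)
  \<comment> \<open>Nonnegativity lets the square cancel the \<open>sqrt\<close> in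
    \<open>sub_norm\<close>.\<close>
  moreover have "0 \<le> z \<bullet> (A *v z)"
    using assms(2) by (cases "z = 0") (auto simp: pos_definite_def less_imp_le)
  ultimately show ?thesis
    by (simp add: sub_norm_def quadratic_form_sum)
qed

lemma closed_vsupp_subset: "closed {b. vsupp b \<subseteq> S}"
proof -
  have "{b. vsupp b \<subseteq> S} = (\<Inter>j\<in>- S. {b. b $ j = 0})"
    by (auto simp: vsupp_def)
  also have "closed \<dots>"
    by (intro closed_INT ballI closed_Collect_eq continuous_intros)
  finally show ?thesis .
qed

lemma vsupp_subset_nonempty: "{b. vsupp b \<subseteq> S} \<noteq> {}"
proof -
  have "vsupp 0 \<subseteq> S" by (simp add: vsupp_def)
  then show ?thesis by blast
qed

text \<open>\<open>arg_min_on\<close> is a Hilbert choice, so membership in the constraint set can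
  be read off once a minimiser is known to exist.\<close>

lemma arg_min_on_mem:
  assumes "\<exists>b. is_arg_min f (\<lambda>b. b \<in> C) b"
  shows "arg_min_on f C \<in> C"
proof -
  have "is_arg_min f (\<lambda>b. b \<in> C) (arg_min_on f C)"
    unfolding arg_min_on_def arg_min_def using someI_ex[OF assms] .
  then show ?thesis by (simp add: is_arg_min_def)
qed

section \<open>Least squares within one environment and pooled over all of them\<close>

locale environments =
  fixes E :: "'e set" and M :: "'e \<Rightarrow> 'w measure"
    and X :: "'e \<Rightarrow> 'w \<Rightarrow> real ^ 'd" and Y :: "'e \<Rightarrow> 'w \<Rightarrow> real"
  assumes fin: "finite E" and ne: "E \<noteq> {}"
    and X: "\<And>e. e \<in> E \<Longrightarrow> second_order (M e) (X e)"
    and Y: "\<And>e. e \<in> E \<Longrightarrow> Y e \<in> borel_measurable (M e)"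
    and Y2: "\<And>e. e \<in> E \<Longrightarrow> integrable (M e) (\<lambda>\<omega>. (Y e \<omega>)\<^sup>2)"
    and pd: "\<And>e. e \<in> E \<Longrightarrow> pos_definite (second_moment (M e) (X e))"
begin

abbreviation "\<Sigma> e \<equiv> second_moment (M e) (X e)"

text \<open>Minus half the gradient of the risk in environment \<open>e\<close> at
  \<open>b\<close>.\<close>

definition "score e b = (\<chi> j. \<integral>\<omega>. X e \<omega> $ j * (Y e \<omega> - b \<bullet> X e \<omega>) \<partial>(M e))"

lemma card_pos: "0 < card E"
  using fin ne by (simp add: card_gt_0_iff)

lemma risk_add:
  "e \<in> E \<Longrightarrow> risk (M e) (X e) (Y e) (b + h)
     = risk (M e) (X e) (Y e) b - 2 * (h \<bullet> score e b) + h \<bullet> (\<Sigma> e *v h)"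
  unfolding score_def by (intro second_order.risk_expand X Y Y2)

lemma risk_eq:
  assumes "e \<in> E"
  shows "risk (M e) (X e) (Y e) b
     = risk (M e) (X e) (Y e) 0 + (- 2 *\<^sub>R score e 0) \<bullet> b + b \<bullet> (\<Sigma> e *v b)"
  using risk_add[OF assms, of 0 b] by (simp add: inner_commute)

lemma sum_risk_add:
  "(\<Sum>e\<in>E. risk (M e) (X e) (Y e) (b + h)) = (\<Sum>e\<in>E. risk (M e) (X e) (Y e) b)
     - 2 * (h \<bullet> (\<Sum>e\<in>E. score e b)) + h \<bullet> ((\<Sum>e\<in>E. \<Sigma> e) *v h)"
  by (simp add: risk_add sum.distrib sum_subtractf sum_distrib_left inner_sum_right
      sum_matrix_form)

lemma sum_risk_eq:
  "(\<Sum>e\<in>E. risk (M e) (X e) (Y e) b) = (\<Sum>e\<in>E. risk (M e) (X e) (Y e) 0)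
     + (- 2 *\<^sub>R (\<Sum>e\<in>E. score e 0)) \<bullet> b + b \<bullet> ((\<Sum>e\<in>E. \<Sigma> e) *v b)"
  using sum_risk_add[of 0 b] by (simp add: inner_commute)

lemma pd_sum: "pos_definite (\<Sum>e\<in>E. \<Sigma> e)"
  by (intro pos_definite_sum fin ne pd)

lemma beta_env_supp:
  assumes "e \<in> E"
  shows "vsupp (beta_env (M e) (X e) (Y e) S) \<subseteq> S"
proof -
  have "\<exists>b. is_arg_min (risk (M e) (X e) (Y e)) (\<lambda>b. b \<in> {b. vsupp b \<subseteq> S}) b"
    \<comment> \<open>There is no penalty here: \<open>add_0_right\<close> supplies the zero term
      that gives the risk the shape required by the rule.\<close>
    by (rule quadratic_minimizer_exists[where p = "\<lambda>_. 0", OF pd[OF assms] closed_vsupp_subset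
          vsupp_subset_nonempty _ _ trans[OF risk_eq[OF assms] add_0_right[symmetric]]]) auto
  from arg_min_on_mem[OF this] show ?thesis
    by (simp add: beta_env_def)
qed

lemma beta_pooled_supp: "vsupp (beta_pooled E M X Y S) \<subseteq> S"
proof -
  have "\<exists>b. is_arg_min (\<lambda>b. \<Sum>e\<in>E. risk (M e) (X e) (Y e) b) (\<lambda>b. b \<in> {b. vsupp b \<subseteq> S}) b"
    by (rule quadratic_minimizer_exists[where p = "\<lambda>_. 0", OF pd_sum closed_vsupp_subset
          vsupp_subset_nonempty _ _ trans[OF sum_risk_eq add_0_right[symmetric]]]) auto
  from arg_min_on_mem[OF this] show ?thesis
    by (simp add: beta_pooled_def)
qed

section \<open>Dispersion of a subset across environments, and the weights\<close>

definition "disp S = avg E (\<lambda>e. (sub_norm (\<Sigma> e) S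
  (beta_env (M e) (X e) (Y e) S - beta_pooled E M X Y S))\<^sup>2)"

abbreviation "w k j \<equiv> w_weight E M X Y k j"

lemma w_eq: "w k j = sqrt (Min (disp ` {S. j \<in> S \<and> card S \<le> k}))"
  by (simp add: w_weight_def disp_def)

lemma disp_nonneg: "0 \<le> disp S"
  by (simp add: disp_def avg_def sum_nonneg)

text \<open>Two distinct environment-wise fits cannot both equal the pooled fit. A nonzero
  difference from the pooled fit is supported in \<open>S\<close>, where \<open>sub_norm\<close> is
  a true norm by positive definiteness, so one summand is positive.\<close>

lemma disp_pos:
  assumes "e \<in> E" "e' \<in> E" "beta_env (M e) (X e) (Y e) S \<noteq> beta_env (M e') (X e') (Y e') S"
  shows "0 < disp S"
proof -
  let ?z = "\<lambda>e. beta_env (M e) (X e) (Y e) S - beta_pooled E M X Y S"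
  obtain a where a: "a \<in> E" "?z a \<noteq> 0"
    using assms by (metis right_minus_eq)
  have "vsupp (?z a) \<subseteq> S"
    using beta_env_supp[OF a(1), of S] beta_pooled_supp[of S]
    by (simp add: vsupp_def subset_iff) metis
  then have "0 < (sub_norm (\<Sigma> a) S (?z a))\<^sup>2"
    using a pd[OF a(1)] by (simp only: sub_norm_supported) (simp add: pos_definite_def)
  then have "0 < (\<Sum>e\<in>E. (sub_norm (\<Sigma> e) S (?z e))\<^sup>2)"
    using a fin by (intro sum_pos2[where i = a]) auto
  then show ?thesis
    using card_pos by (simp add: disp_def avg_def)
qed

text \<open>The singleton of \<open>j\<close> is admissible since \<open>k\<close> is at least 1.
  Nonemptiness is what makes the \<open>Min\<close> in the weight a value that is attained.\<close>

lemma weight_family_nonempty: "1 \<le> k \<Longrightarrow> {S :: 'd set. j \<in> S \<and> card S \<le> k} \<noteq> {}"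
  by (auto intro!: exI[of _ "{j}"])

lemma w_nonneg: "1 \<le> k \<Longrightarrow> 0 \<le> w k j"
  using weight_family_nonempty[of k j] by (auto simp: w_eq disp_nonneg)

text \<open>Dispersions are nonnegative, so a set of dispersion zero attains the minimum.\<close>

lemma w_eq_0:
  assumes "card S \<le> k" "j \<in> S"
    and "\<And>e. e \<in> E \<Longrightarrow> beta_env (M e) (X e) (Y e) S = beta_pooled E M X Y S"
  shows "w k j = 0"
proof -
  have "disp S = 0"
    using assms(3) by (simp add: disp_def avg_def sub_norm_def)
  then have "Min (disp ` {S. j \<in> S \<and> card S \<le> k}) = 0"
    using assms by (intro Min_eqI) (auto simp: disp_nonneg image_iff)
  then show ?thesis by (simp add: w_eq)
qed

lemma w_pos:
  assumes "1 \<le> k" "\<And>S. j \<in> S \<Longrightarrow> 0 < disp S"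
  shows "0 < w k j"
  using assms weight_family_nonempty[of k j] by (auto simp: w_eq)

section \<open>The penalised objective: unique minimiser and optimality conditions\<close>

lemma Q_minimizer:
  assumes "1 \<le> k" "0 \<le> \<gamma>"
  shows "\<exists>!b. is_arg_min (Q_obj E M X Y k \<gamma>) (\<lambda>b. b \<in> UNIV) b"
proof -
  let ?p = "\<lambda>b. \<gamma> * (\<Sum>j\<in>UNIV. \<bar>b $ j\<bar> * w k j)"
  let ?t = "1 / (2 * real (card E))"
  \<comment> \<open>This is the form shared by the existence and uniqueness lemmas: constant, linear
    part, positive definite quadratic part, and the penalty in the role of \<open>p\<close>.\<close>
  have Q: "Q_obj E M X Y k \<gamma> b = ?t * (\<Sum>e\<in>E. risk (M e) (X e) (Y e) 0)
      + (?t *\<^sub>R (- 2 *\<^sub>R (\<Sum>e\<in>E. score e 0))) \<bullet> b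
      + b \<bullet> ((?t *\<^sub>R (\<Sum>e\<in>E. \<Sigma> e)) *v b) + ?p b" for b
    unfolding Q_obj_def sum_risk_eq[of b]
    by (simp add: scaleR_matrix_vector_assoc[symmetric] distrib_left diff_divide_distrib)
  have pdt: "pos_definite (?t *\<^sub>R (\<Sum>e\<in>E. \<Sigma> e))"
    using card_pos by (intro pos_definite_scaleR pd_sum) simp
  have "\<exists>b. is_arg_min (Q_obj E M X Y k \<gamma>) (\<lambda>b. b \<in> UNIV) b"
    by (rule quadratic_minimizer_exists[OF pdt closed_UNIV _ _ _ Q])
      (auto intro!: continuous_intros mult_nonneg_nonneg sum_nonneg w_nonneg assms)
  moreover have "x = y" if "is_arg_min (Q_obj E M X Y k \<gamma>) (\<lambda>b. b \<in> UNIV) x"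
    "is_arg_min (Q_obj E M X Y k \<gamma>) (\<lambda>b. b \<in> UNIV) y" for x y
  proof (rule quadratic_minimizer_unique[OF pdt _ Q])
    show "convex_on UNIV ?p"
    proof (rule convex_onI)
      fix t :: real and a b :: "real ^ 'd"
      assume t: "0 < t" "t < 1"
      \<comment> \<open>Convexity of the penalty is checked coordinate by coordinate; multiplying
        the triangle inequality by \<open>w k j\<close> uses \<open>w_nonneg\<close>.\<close>
      have "\<bar>(1 - t) * a $ j + t * b $ j\<bar> * w k j
          \<le> (1 - t) * (\<bar>a $ j\<bar> * w k j) + t * (\<bar>b $ j\<bar> * w k j)" for j
      proof -
        have "\<bar>(1 - t) * a $ j + t * b $ j\<bar> \<le> (1 - t) * \<bar>a $ j\<bar> + t * \<bar>b $ j\<bar>"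
          using t abs_triangle_ineq[of "(1 - t) * a $ j" "t * b $ j"] by (simp add: abs_mult)
        from mult_right_mono[OF this w_nonneg[OF assms(1), of j]] show ?thesis
          by (simp add: algebra_simps)
      qed
      then have "(\<Sum>j\<in>UNIV. \<bar>(1 - t) * a $ j + t * b $ j\<bar> * w k j)
          \<le> (\<Sum>j\<in>UNIV. (1 - t) * (\<bar>a $ j\<bar> * w k j) + t * (\<bar>b $ j\<bar> * w k j))"
        by (intro sum_mono)
      from mult_left_mono[OF this assms(2)]
      show "?p ((1 - t) *\<^sub>R a + t *\<^sub>R b) \<le> (1 - t) * ?p a + t * ?p b"
        by (simp add: sum.distrib sum_distrib_left[symmetric] distrib_left mult.left_commute)
    qed simp
  qed (use that in \<open>auto simp: is_arg_min_linorder\<close>)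
  ultimately show ?thesis by blast
qed

text \<open>The two hypotheses are the Karush-Kuhn-Tucker conditions for the penalised problem at
  \<open>b\<close>, restricted to the case that the penalty vanishes there.\<close>

lemma Q_minimal:
  assumes "\<And>j. b $ j \<noteq> 0 \<Longrightarrow> w k j = 0"
    and "\<And>j. \<bar>avg E (\<lambda>e. score e b $ j)\<bar> \<le> \<gamma> * w k j"
  shows "Q_obj E M X Y k \<gamma> b \<le> Q_obj E M X Y k \<gamma> b'"
proof -
  define h where "h = b' - b"
  define r where "r j = avg E (\<lambda>e. score e b $ j)" for j
  have b': "b' = b + h" by (simp add: h_def)
  let ?t = "1 / (2 * real (card E))"
  \<comment> \<open>Each coordinate of the first-order gain is paid for by the penalty at
    \<open>b'\<close>. If \<open>b $ j = 0\<close>, then \<open>h $ j = b' $ j\<close> and the bound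
    on \<open>r j\<close> applies; otherwise \<open>w k j = 0\<close> forces
    \<open>r j = 0\<close>.\<close>
  have pen: "h $ j * r j \<le> \<gamma> * (\<bar>b' $ j\<bar> * w k j)" for j
  proof (cases "b $ j = 0")
    case True
    have "h $ j * r j \<le> \<bar>h $ j\<bar> * \<bar>r j\<bar>"
      using abs_ge_self[of "h $ j * r j"] by (simp add: abs_mult)
    also have "\<dots> \<le> \<bar>h $ j\<bar> * (\<gamma> * w k j)"
      using assms(2)[of j] by (intro mult_left_mono) (auto simp: r_def)
    finally show ?thesis using True by (simp add: b' mult.left_commute)
  next
    case False
    then show ?thesis using assms(2)[of j] assms(1)[of j] by (simp add: r_def)
  qed
  \<comment> \<open>The factor 2 from the expansion cancels the one in \<open>?t\<close>, leaving
    the average over environments.\<close>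
  have "?t * (2 * (h \<bullet> (\<Sum>e\<in>E. score e b))) = (\<Sum>j\<in>UNIV. h $ j * r j)"
    by (simp add: inner_vec_sum r_def avg_def sum_distrib_left sum_divide_distrib)
  also have "\<dots> \<le> \<gamma> * (\<Sum>j\<in>UNIV. \<bar>b' $ j\<bar> * w k j)"
    unfolding sum_distrib_left by (intro sum_mono pen)
  finally have lin: "?t * (2 * (h \<bullet> (\<Sum>e\<in>E. score e b))) \<le> \<gamma> * (\<Sum>j\<in>UNIV. \<bar>b' $ j\<bar> * w k j)" .
  have "0 \<le> h \<bullet> ((\<Sum>e\<in>E. \<Sigma> e) *v h)"
    using pd_sum by (cases "h = 0") (auto simp: pos_definite_def less_imp_le)
  then have quad: "0 \<le> ?t * (h \<bullet> ((\<Sum>e\<in>E. \<Sigma> e) *v h))"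
    by simp
  have "(\<Sum>j\<in>UNIV. \<bar>b $ j\<bar> * w k j) = 0"
    using assms(1) by (intro sum.neutral) auto
  then have "Q_obj E M X Y k \<gamma> b = ?t * (\<Sum>e\<in>E. risk (M e) (X e) (Y e) b)"
    by (simp add: Q_obj_def)
  also have "\<dots> \<le> ?t * (\<Sum>e\<in>E. risk (M e) (X e) (Y e) b)
      - ?t * (2 * (h \<bullet> (\<Sum>e\<in>E. score e b))) + ?t * (h \<bullet> ((\<Sum>e\<in>E. \<Sigma> e) *v h))
      + \<gamma> * (\<Sum>j\<in>UNIV. \<bar>b' $ j\<bar> * w k j)"
    using lin quad by linarith
  also have "\<dots> = Q_obj E M X Y k \<gamma> b'"
    unfolding Q_obj_def b' sum_risk_add by (simp only: distrib_left right_diff_distrib)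
  finally show ?thesis .
qed

end

section \<open>Recovery of the invariant parameter\<close>

theorem theorem3p3:
  fixes E :: "'e set"
    and M :: "'e \<Rightarrow> 'w measure"
    and X :: "'e \<Rightarrow> 'w \<Rightarrow> real ^ 'd"
    and Y :: "'e \<Rightarrow> 'w \<Rightarrow> real"
    and \<epsilon> :: "'e \<Rightarrow> 'w \<Rightarrow> real"
    and \<beta>star :: "real ^ 'd"
    and Sstar G :: "'d set"
    and k :: nat
    and \<gamma> :: real
  assumes "finite E" and "E \<noteq> {}"
    and "\<And>e. e \<in> E \<Longrightarrow> prob_space (M e)"
    and "\<And>e. e \<in> E \<Longrightarrow> X e \<in> borel_measurable (M e)"
    and "\<And>e. e \<in> E \<Longrightarrow> Y e \<in> borel_measurable (M e)"
    and "\<And>e. e \<in> E \<Longrightarrow> integrable (M e) (\<lambda>\<omega>. (norm (X e \<omega>))\<^sup>2)"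
    and "\<And>e. e \<in> E \<Longrightarrow> integrable (M e) (\<lambda>\<omega>. (Y e \<omega>)\<^sup>2)"
    and "\<And>e. e \<in> E \<Longrightarrow> pos_definite (second_moment (M e) (X e))"
    and "\<And>j. avg_second_moment E M X $ j $ j = 1"
    and "1 \<le> k" and "k \<le> CARD('d)" and "0 \<le> \<gamma>"
    and "Sstar = vsupp \<beta>star"
    and "\<And>e. e \<in> E \<Longrightarrow> \<epsilon> e \<in> borel_measurable (M e)"
    and "\<And>e. e \<in> E \<Longrightarrow>
           AE \<omega> in M e. Y e \<omega> = (\<Sum>j\<in>Sstar. \<beta>star $ j * X e \<omega> $ j) + \<epsilon> e \<omega>"
    and "\<And>e j. e \<in> E \<Longrightarrow> j \<in> Sstar \<Longrightarrow> (\<integral>\<omega>. X e \<omega> $ j * \<epsilon> e \<omega> \<partial>(M e)) = 0"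
    and "G = endogenous_set E M X \<epsilon> Sstar"
    and "\<And>S. S \<inter> G \<noteq> {} \<Longrightarrow>
           \<exists>e\<in>E. \<exists>e'\<in>E. beta_env (M e) (X e) (Y e) S \<noteq> beta_env (M e') (X e') (Y e') S"
    and "\<And>j. j \<in> Sstar \<Longrightarrow>
           \<exists>S. card S \<le> k \<and> j \<in> S \<and>
             (\<forall>e\<in>E. beta_env (M e) (X e) (Y e) S = beta_pooled E M X Y S)"
  shows "(\<exists>!b. is_arg_min (Q_obj E M X Y k \<gamma>) (\<lambda>b. b \<in> UNIV) b) \<and>
         (\<gamma> \<ge> gamma_star E M X Y \<epsilon> k G \<longrightarrow> beta_reg E M X Y k \<gamma> = \<beta>star)"
proof -
  interpret environments E M X Y
    using assms(1-8) by unfold_locales (auto simp: second_order_def)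
  have uniq: "\<exists>!b. is_arg_min (Q_obj E M X Y k \<gamma>) (\<lambda>b. b \<in> UNIV) b"
    using Q_minimizer assms(10,12) .
  have supp: "b \<in> Sstar \<longleftrightarrow> \<beta>star $ b \<noteq> 0" for b
    using assms(13) by (simp add: vsupp_def)
  \<comment> \<open>Since \<open>\<beta>star\<close> vanishes off \<open>Sstar\<close>, the sum in
    the invariance equation is the full inner product, so the residual at \<open>\<beta>star\<close>
    is almost everywhere the noise \<open>\<epsilon> e\<close>.\<close>
  have score: "score e \<beta>star $ j = (\<integral>\<omega>. X e \<omega> $ j * \<epsilon> e \<omega> \<partial>(M e))" if "e \<in> E" for e j
  proof -
    interpret second_order "M e" "X e" using X that .
    have "(\<Sum>j\<in>Sstar. \<beta>star $ j * x $ j) = \<beta>star \<bullet> x" for x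
      unfolding inner_vec_sum by (intro sum.mono_neutral_left) (auto simp: supp)
    then have "AE \<omega> in M e. X e \<omega> $ j * (Y e \<omega> - \<beta>star \<bullet> X e \<omega>) = X e \<omega> $ j * \<epsilon> e \<omega>"
      using assms(15)[OF that] by (auto elim: eventually_mono)
    then show ?thesis
      unfolding score_def using Y[OF that] assms(14)[OF that]
      by (simp add: integral_cong_AE)
  qed
  define r where "r j = avg E (\<lambda>e. \<integral>\<omega>. X e \<omega> $ j * \<epsilon> e \<omega> \<partial>(M e))" for j
  have avg_score: "avg E (\<lambda>e. score e \<beta>star $ j) = r j" for j
    by (simp add: r_def avg_def score)
  have G: "G = {j. j \<notin> Sstar \<and> r j \<noteq> 0}"
    using assms(17) by (simp add: endogenous_set_def r_def mult.commute)
  have w0: "w k j = 0" if "j \<in> Sstar" for j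
    using assms(19)[OF that] w_eq_0 by blast
  \<comment> \<open>Every \<open>S\<close> containing \<open>j\<close> meets \<open>G\<close>, so
    identification yields two environments with different fits on \<open>S\<close>, and the
    dispersion of each candidate set is positive.\<close>
  have wG: "0 < w k j" if "j \<in> G" for j
    using that assms(18) disp_pos by (intro w_pos assms(10)) blast
  have "beta_reg E M X Y k \<gamma> = \<beta>star" if \<gamma>: "gamma_star E M X Y \<epsilon> k G \<le> \<gamma>"
  proof -
    \<comment> \<open>On \<open>G\<close> this is the threshold on \<gamma> multiplied by the
      positive weight. Elsewhere \<open>r j\<close> is zero: on \<open>Sstar\<close> by exogeneity
      of the noise, off \<open>Sstar\<close> by the definition of \<open>G\<close>.\<close>
    have "\<bar>r j\<bar> \<le> \<gamma> * w k j" for j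
    proof (cases "j \<in> G")
      case True
      then have "\<bar>r j\<bar> / w k j \<le> gamma_star E M X Y \<epsilon> k G"
        unfolding gamma_star_def r_def by (auto intro!: Max_ge)
      with \<gamma> wG[OF True] show ?thesis by (simp add: pos_divide_le_eq[symmetric])
    next
      case False
      have "r j = 0"
      proof (cases "j \<in> Sstar")
        case True
        then show ?thesis by (simp add: r_def avg_def assms(16))
      qed (use False G in auto)
      then show ?thesis using assms(12) w_nonneg[OF assms(10)] by simp
    qed
    then have "Q_obj E M X Y k \<gamma> \<beta>star \<le> Q_obj E M X Y k \<gamma> b" for b
      using w0 supp by (intro Q_minimal) (auto simp: avg_score)
    then have "is_arg_min (Q_obj E M X Y k \<gamma>) (\<lambda>b. b \<in> UNIV) \<beta>star"
      by (simp add: is_arg_min_linorder)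
    \<comment> \<open>Uniqueness of the minimiser determines the choice made by
      \<open>arg_min_on\<close> in \<open>beta_reg\<close>.\<close>
    with uniq show ?thesis
      unfolding beta_reg_def arg_min_on_def arg_min_def by (intro some_equality) auto
  qed
  with uniq show ?thesis by blast
qed

end
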